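(* The set of prime elements of $\mathbb{Z}[k]$ is $\{z\in\mathbb{Z}[k] : z=uk \text{ with } u \text{ a unit of } \mathbb{Z}[k]\}=\{k,-k\}$; that is, it coincides with the set of irreducible elements of $\mathbb{Z}[k]$ contained in $\mathcal{D}$.
   Context: $\mathbb{Z}[k]$ denotes the commutative ring of formal expressions $x+ky$ with $x,y\in\mathbb{Z}$, with componentwise addition and multiplication determined by distributivity and $k^2=0$; that is, $\mathbb{Z}[k]\cong\mathbb{Z}[X]/(X^2)$. $\mathcal{D}=\{ky : y\in\mathbb{Z}\}$ is its set of zero divisors (including $0$). An element $p$ is prime if it is non-zero, not a unit, and $p\mid xy$ implies $p\mid x$ or $p\mid y$. An element $a$ is irreducible if it is non-zero, not a unit, and $a=zw$ implies that $z$ is a unit or $w$ is a unit. *)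

theory Defs
  imports "HOL-Computational_Algebra.Factorial_Ring"
begin

text \<open>The ring \<open>\<int>[k]\<close>: the value \<open>Zk x y\<close> stands for the formal expression \<open>x + k y\<close>.\<close>

datatype zk = Zk (fin_part: int) (inf_part: int)

instantiation zk :: comm_ring_1
begin

definition zero_zk :: zk where "0 = Zk 0 0"

definition one_zk :: zk where "1 = Zk 1 0"

definition plus_zk :: "zk \<Rightarrow> zk \<Rightarrow> zk" where
  "z + w = Zk (fin_part z + fin_part w) (inf_part z + inf_part w)"

definition uminus_zk :: "zk \<Rightarrow> zk" where
  "- z = Zk (- fin_part z) (- inf_part z)"

definition minus_zk :: "zk \<Rightarrow> zk \<Rightarrow> zk" where
  "z - w = Zk (fin_part z - fin_part w) (inf_part z - inf_part w)"

text \<open>\<open>(a + k b) (c + k d) = a c + k (a d + b c)\<close>, as \<open>k\<^sup>2 = 0\<close>.\<close>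

definition times_zk :: "zk \<Rightarrow> zk \<Rightarrow> zk" where
  "z * w = Zk (fin_part z * fin_part w)
              (fin_part z * inf_part w + inf_part z * fin_part w)"

instance
  by standard
    (auto simp: zero_zk_def one_zk_def plus_zk_def uminus_zk_def minus_zk_def
      times_zk_def algebra_simps)

end

definition kk :: zk where "kk = Zk 0 1"

lemma kk_squared: "kk\<^sup>2 = 0"
  by (simp add: power2_eq_square kk_def times_zk_def zero_zk_def)

lemma of_int_zk: "of_int x = Zk x 0"
proof -
  have nat: "of_nat n = Zk (int n) 0" for n
    by (induction n) (auto simp: zero_zk_def one_zk_def plus_zk_def)
  show ?thesis
    by (cases x rule: int_cases2) (auto simp: nat uminus_zk_def)
qed

lemma Zk_eq: "Zk x y = of_int x + kk * of_int y"
  by (simp add: of_int_zk kk_def plus_zk_def times_zk_def)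

definition zk_zero_divisors :: "zk set" where
  "zk_zero_divisors = {kk * of_int y | y :: int. True}"

lemma zk_zero_divisors_iff:
  "z \<in> zk_zero_divisors \<longleftrightarrow> (\<exists>w. w \<noteq> 0 \<and> z * w = 0)"
proof
  assume "z \<in> zk_zero_divisors"
  then have "z * kk = 0"
    by (auto simp: zk_zero_divisors_def of_int_zk kk_def times_zk_def zero_zk_def)
  moreover have "kk \<noteq> 0"
    by (simp add: kk_def zero_zk_def)
  ultimately show "\<exists>w. w \<noteq> 0 \<and> z * w = 0" by blast
next
  assume "\<exists>w. w \<noteq> 0 \<and> z * w = 0"
  then obtain w where w: "w \<noteq> 0" "z * w = 0" by blast
  have "fin_part z = 0"
    using w by (cases z; cases w) (auto simp: times_zk_def zero_zk_def)
  then have "z = kk * of_int (inf_part z)"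
    by (cases z) (simp add: of_int_zk kk_def times_zk_def)
  then show "z \<in> zk_zero_divisors"
    unfolding zk_zero_divisors_def by blast
qed

end

(* A prime divides k^2 = 0, hence divides k.  As k is irreducible, the prime is a unit multiple
   of k, and a unit has finite part 1 or -1.  Conversely k divides exactly the elements with
   finite part 0, so it is prime. *)

theory Submission
  imports Defs
begin

text \<open>Taking the finite part is a ring homomorphism onto the integers, so it sends units to
  units. The converse uses conjugation.\<close>

lemma zk_unit_iff: "z dvd 1 \<longleftrightarrow> \<bar>fin_part z\<bar> = 1"
proof
  assume "z dvd 1"
  then have "fin_part z dvd 1"
    by (auto simp: dvd_def one_zk_def times_zk_def)
  then show "\<bar>fin_part z\<bar> = 1" by simp
next
  assume "\<bar>fin_part z\<bar> = 1"
  \<comment> \<open>The witness is the conjugate \<open>x - k y\<close> of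
    \<open>z = x + k y\<close>: their product is \<open>x * x\<close>, which is 1 here.\<close>
  then have "1 = z * Zk (fin_part z) (- inf_part z)"
    by (auto simp: one_zk_def times_zk_def abs_if split: if_splits)
  then show "z dvd 1" by (rule dvdI)
qed

text \<open>Since k squares to 0, \<open>u * kk\<close> depends only on the finite part of
  \<open>u\<close>, which is 1 or -1 for a unit.\<close>

lemma zk_unit_multiples_kk: "{z. \<exists>u. u dvd 1 \<and> z = u * kk} = {kk, - kk}"
proof -
  have "u * kk = kk \<or> u * kk = - kk" if "u dvd 1" for u
    using that by (auto simp: zk_unit_iff kk_def times_zk_def uminus_zk_def)
  moreover have "1 dvd (1 :: zk)" "kk = 1 * kk" "- 1 dvd (1 :: zk)" "- kk = - 1 * kk"
    by simp_all
  ultimately show ?thesis by blast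
qed

lemma kk_dvd_iff: "kk dvd z \<longleftrightarrow> fin_part z = 0"
proof
  assume "kk dvd z"
  then show "fin_part z = 0" by (auto simp: kk_def times_zk_def)
next
  assume "fin_part z = 0"
  then have "z = kk * of_int (inf_part z)"
    by (cases z) (simp add: of_int_zk kk_def times_zk_def)
  then show "kk dvd z" by (rule dvdI)
qed

lemma kk_not_unit: "\<not> kk dvd 1"
  by (simp add: kk_dvd_iff one_zk_def)

lemma prime_elem_kk: "prime_elem kk"
proof (rule prime_elemI)
  show "kk \<noteq> 0" by (simp add: kk_def zero_zk_def)
  show "\<not> kk dvd 1" by (rule kk_not_unit)
  \<comment> \<open>Finite parts multiply, and the integers have no zero divisors.\<close>
  show "kk dvd a \<or> kk dvd b" if "kk dvd a * b" for a b
    using that by (simp add: kk_dvd_iff times_zk_def)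
qed

(* The library's implication from prime to irreducible requires a domain. *)
lemma irreducible_kk: "irreducible kk"
proof (rule irreducibleI)
  show "kk \<noteq> 0" by (simp add: kk_def zero_zk_def)
  show "\<not> kk dvd 1" by (rule kk_not_unit)
  show "a dvd 1 \<or> b dvd 1" if "kk = a * b" for a b
  proof -
    have fin: "fin_part a * fin_part b = 0"
      and inf: "fin_part a * inf_part b + inf_part a * fin_part b = 1"
      using that by (auto simp: kk_def times_zk_def)
    \<comment> \<open>When one finite part vanishes, a single summand of \<open>inf\<close>
      survives: a product of two integers equal to 1.\<close>
    from inf have "fin_part a = 0 \<Longrightarrow> \<bar>fin_part b\<bar> = 1"
      and "fin_part b = 0 \<Longrightarrow> \<bar>fin_part a\<bar> = 1"
      by (auto simp: zmult_eq_1_iff)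
    with fin show ?thesis by (auto simp: zk_unit_iff)
  qed
qed

lemma prime_elem_zk_cases:
  assumes "prime_elem p"
  shows "p = kk \<or> p = - kk"
proof -
  have "p dvd kk * kk"
    using kk_squared by (simp add: power2_eq_square)
  then have "p dvd kk"
    using assms by (auto dest: prime_elem_dvd_multD)
  then obtain w where w: "kk = p * w" ..
  have "\<not> p dvd 1" using assms by (rule prime_elem_not_unit)
  moreover have "p dvd 1 \<or> w dvd 1"
    using irreducible_kk w by (rule irreducibleD)
  ultimately have "\<bar>fin_part w\<bar> = 1" by (simp add: zk_unit_iff)
  moreover have "fin_part p * fin_part w = 0"
    and "fin_part p * inf_part w + inf_part p * fin_part w = 1"
    using w by (auto simp: kk_def times_zk_def)
  \<comment> \<open>As \<open>fin_part w\<close> is 1 or -1, the first equation kills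
    \<open>fin_part p\<close>, and the second reduces to
    \<open>inf_part p * fin_part w = 1\<close>.\<close>
  ultimately have "fin_part p = 0" "\<bar>inf_part p\<bar> = 1"
    by (auto simp: zmult_eq_1_iff)
  then show ?thesis
    by (cases p) (auto simp: kk_def uminus_zk_def)
qed

text \<open>A zero divisor comes with a factor \<open>kk\<close>, which is not a unit, so
  irreducibility makes the integer cofactor a unit.\<close>

lemma irreducible_zero_divisor_cases:
  assumes "irreducible a" "a \<in> zk_zero_divisors"
  shows "a = kk \<or> a = - kk"
proof -
  obtain y where y: "a = kk * of_int y"
    using assms(2) by (auto simp: zk_zero_divisors_def)
  then have "(of_int y :: zk) dvd 1"
    using irreducibleD[OF assms(1) y] kk_not_unit by blast
  then have "\<bar>y\<bar> = 1" by (simp add: zk_unit_iff of_int_zk)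
  then show ?thesis using y by (auto simp: abs_if split: if_splits)
qed

lemma prime_elem_minus_kk: "prime_elem (- kk)"
  using prime_elem_kk by (simp add: prime_elem_def)

lemma irreducible_minus_kk: "irreducible (- kk)"
proof (rule irreducibleI)
  show "- kk \<noteq> 0" by (simp add: kk_def zero_zk_def uminus_zk_def)
  show "\<not> - kk dvd 1" by (simp add: kk_not_unit)
  show "a dvd 1 \<or> b dvd 1" if "- kk = a * b" for a b
  proof -
    \<comment> \<open>Moving the sign onto \<open>a\<close> yields a factorization of
      \<open>kk\<close>, and \<open>- a\<close> is a unit exactly when \<open>a\<close> is.\<close>
    have "kk = - a * b" using that by (metis minus_minus mult_minus_left)
    then show ?thesis using irreducibleD[OF irreducible_kk] by fastforce
  qed
qed

theorem corollary2:
  "{p :: zk. prime_elem p} = {z :: zk. \<exists>u. u dvd 1 \<and> z = u * kk} \<and>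
   {z :: zk. \<exists>u. u dvd 1 \<and> z = u * kk} = {kk, - kk} \<and>
   {p :: zk. prime_elem p} = {a :: zk. irreducible a} \<inter> zk_zero_divisors"
proof -
  have "{p :: zk. prime_elem p} = {kk, - kk}"
    using prime_elem_zk_cases prime_elem_kk prime_elem_minus_kk by blast
  moreover have "kk = kk * of_int 1" "- kk = kk * of_int (- 1)" by simp_all
  then have "kk \<in> zk_zero_divisors" "- kk \<in> zk_zero_divisors"
    unfolding zk_zero_divisors_def by blast+
  then have "{a :: zk. irreducible a} \<inter> zk_zero_divisors = {kk, - kk}"
    using irreducible_zero_divisor_cases irreducible_kk irreducible_minus_kk by blast
  ultimately show ?thesis using zk_unit_multiples_kk by simp
qed

end
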